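(* Let $m\ge 1$ be an integer. Let the vector $\eta=(\eta_1,\ldots,\eta_m)$ be uniformly distributed on the part of the unit sphere $S^{m-1}$ of $\mathbb{R}^m$ consisting of points with strictly positive components, and let $$X(\eta)=\sum_{i=1}^m\eta_i^4.$$ Then the expected value and the variance of the random variable $X$ are $$\mathbb{E}(X)=\frac{3}{m+2},\quad \mathbb{V}(X)=\frac{24m-24}{(m+2)^2(m+4)(m+6)}.$$
   Context: Uniform distribution on a part of the sphere means with respect to the normalized surface measure. In the paper, $\eta_i=\sigma_i/\sqrt{n}$ are the normalized singular values of a real $(n\times m)$-matrix $T$ of full rank $m<n$, scaled such that $\sum_i\eta_i^2=1$. *)

theory Defs
  imports "HOL-Probability.Probability"
begin

text \<open>
  The surface measure of the unit sphere, as a Borel measure on the ambient space concentrated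
  on the sphere: the surface measure of a Borel set \<open>A\<close> of unit vectors is \<open>DIM('a)\<close> times the
  Lebesgue measure of the cone \<open>{r *\<^sub>R x | 0 < r < 1, x \<in> A}\<close> (see \<open>emeasure_sphere_surface\<close>
  below). The factor \<open>DIM('a)\<close> is the one of integration in polar coordinates,
  \<open>dx = r ^ (DIM('a) - 1) dr d\<sigma>\<close>; in dimension one the result is the counting measure on
  \<open>{-1, 1}\<close>.
\<close>

definition sphere_surface :: "'a::euclidean_space measure" where
  "sphere_surface =
     scale_measure (ennreal (real DIM('a)))
       (distr (restrict_space lborel (ball 0 1 - {0})) borel (\<lambda>x. x /\<^sub>R norm x))"

lemma sets_sphere_surface [simp, measurable_cong]: "sets sphere_surface = sets borel"
  by (simp add: sphere_surface_def)

lemma emeasure_sphere_surface: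
  fixes A :: "'a::euclidean_space set"
  assumes A: "A \<in> sets borel" "A \<subseteq> sphere 0 1"
  shows "emeasure sphere_surface A =
           ennreal (real DIM('a)) * emeasure lborel {r *\<^sub>R x | r x. 0 < r \<and> r < 1 \<and> x \<in> A}"
proof -
  let ?B = "ball (0::'a) 1 - {0}"
  have [measurable]: "(\<lambda>x::'a. x /\<^sub>R norm x) \<in> restrict_space lborel ?B \<rightarrow>\<^sub>M borel"
    by (rule measurable_restrict_space1) simp
  have "(\<lambda>x. x /\<^sub>R norm x) -` A \<inter> ?B = {r *\<^sub>R x | r x. 0 < r \<and> r < 1 \<and> x \<in> A}" (is "?L = ?R")
  proof
    show "?L \<subseteq> ?R"
    proof
      fix y assume y: "y \<in> ?L"
      then have "y = norm y *\<^sub>R (y /\<^sub>R norm y)" "0 < norm y" "norm y < 1" "y /\<^sub>R norm y \<in> A"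
        by auto
      then show "y \<in> ?R" by blast
    qed
    show "?R \<subseteq> ?L"
    proof
      fix y assume "y \<in> ?R"
      then obtain r x where *: "y = r *\<^sub>R x" "0 < r" "r < 1" "x \<in> A" by blast
      moreover from this A have "norm x = 1" by auto
      ultimately show "y \<in> ?L" by auto
    qed
  qed
  moreover have "?R \<subseteq> ?B"
    using calculation by blast
  then have "emeasure (restrict_space lborel ?B) ?R = emeasure lborel ?R"
    by (intro emeasure_restrict_space) auto
  ultimately show ?thesis
    using A by (simp add: sphere_surface_def emeasure_distr space_restrict_space)
qed

definition pos_sphere :: "(real ^ 'm) set" where
  "pos_sphere = {x \<in> sphere 0 1. \<forall>i. 0 < x $ i}"

end

theory Submission imports Defs begin

text \<open>
  Integrate a monomial in the coordinates against \<open>exp (- (norm x)\<^sup>2)\<close> over the positive orthant.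
  In Cartesian coordinates this is a product of one-dimensional half-line Gaussian moments; in
  polar coordinates it is the integral of the monomial over the positive part of the sphere times
  another such moment. Hence all monomial moments of the uniform distribution on that part are
  quotients of Gamma values, and the first two moments of \<open>X\<close> are sums of these.
\<close>

section \<open>Surface measure and integration in polar coordinates\<close>

lemma normalize_measurable [measurable]:
  "(\<lambda>x::'a::euclidean_space. x /\<^sub>R norm x) \<in> borel \<rightarrow>\<^sub>M borel"
  by simp

text \<open>Writing the cone as a preimage under normalization gives a form for every Borel set
  \<open>A\<close>, as needed to compare measures below. As \<open>x /\<^sub>R norm x\<close> is
  \<open>0\<close> at the origin, the cone contains the origin exactly when
  \<open>0 \<in> A\<close>; a single point is a null set.\<close>

lemma emeasure_sphere_surface_vimage:
  fixes A :: "'a::euclidean_space set"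
  assumes [measurable]: "A \<in> sets borel"
  shows "emeasure sphere_surface A =
    ennreal (real DIM('a)) * emeasure lborel {x. x /\<^sub>R norm x \<in> A \<and> norm x < 1}"
proof -
  let ?B = "ball (0::'a) 1 - {0}"
  let ?S = "{x. x /\<^sub>R norm x \<in> A \<and> norm x < 1}"
  have [measurable]: "(\<lambda>x::'a. x /\<^sub>R norm x) \<in> restrict_space lborel ?B \<rightarrow>\<^sub>M borel"
    by (rule measurable_restrict_space1) simp
  have eq: "(\<lambda>x. x /\<^sub>R norm x) -` A \<inter> ?B = ?S - {0}"
    by auto
  have "emeasure (restrict_space lborel ?B) (?S - {0}) = emeasure lborel (?S - {0})"
    by (intro emeasure_restrict_space) auto
  also have "\<dots> = emeasure lborel ?S"
    by (intro emeasure_Diff_null_set) (auto simp: null_sets_def)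
  finally show ?thesis
    using assms eq by (simp add: sphere_surface_def emeasure_distr space_restrict_space)
qed

text \<open>Dilation by \<open>a\<close> maps the cone truncated at radius 1 onto the cone truncated
  at radius \<open>a\<close> and multiplies Lebesgue measure by \<open>a ^ DIM('a)\<close>.\<close>

lemma emeasure_lborel_cone_scale:
  fixes A :: "'a::euclidean_space set"
  assumes [measurable]: "A \<in> sets borel" and a: "0 < a"
  shows "emeasure lborel {x. x /\<^sub>R norm x \<in> A \<and> norm x < a} =
    ennreal (a ^ DIM('a)) * emeasure lborel {x. x /\<^sub>R norm x \<in> A \<and> norm x < 1}"
proof -
  let ?S = "\<lambda>a. {x::'a. x /\<^sub>R norm x \<in> A \<and> norm x < a}"
  have vim: "(\<lambda>x. 0 + a *\<^sub>R x) -` ?S a = ?S 1"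
    using a by (auto simp: divide_simps)
  have "emeasure lborel (?S a) =
      emeasure (density (distr lborel borel (\<lambda>x::'a. 0 + a *\<^sub>R x)) (\<lambda>_. \<bar>a\<bar>^DIM('a))) (?S a)"
    using a by (subst lborel_affine[of a 0]) auto
  also have "\<dots> = ennreal (a ^ DIM('a)) * emeasure (distr lborel borel (\<lambda>x::'a. 0 + a *\<^sub>R x)) (?S a)"
    using a by (subst emeasure_density_const) auto
  also have "emeasure (distr lborel borel (\<lambda>x::'a. 0 + a *\<^sub>R x)) (?S a) = emeasure lborel (?S 1)"
    by (subst emeasure_distr) (simp_all only: vim space_lborel Int_UNIV_right, measurable)
  finally show ?thesis .
qed

text \<open>Polar coordinates with the set of directions fixed: on the cone over \<open>A\<close>,
  the radius has density proportional to \<open>r ^ (DIM('a) - 1)\<close>, with the surface measure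
  of \<open>A\<close> as the constant.\<close>

lemma distr_norm_cone:
  fixes A :: "'a::euclidean_space set"
  assumes [measurable]: "A \<in> sets borel"
  shows "distr (density lborel (\<lambda>x. indicator A (x /\<^sub>R norm x))) borel norm =
    density lborel (\<lambda>r. emeasure sphere_surface A * ennreal (indicator {0<..} r * r ^ (DIM('a) - 1)))"
    (is "?L = ?R")
proof (rule measure_eqI_generator_eq)
  \<comment> \<open>Both sides give \<open>{..<a}\<close> the measure of a truncated cone, which scales like \<open>a ^ DIM('a)\<close>.\<close>
  let ?S = "\<lambda>a. {x::'a. x /\<^sub>R norm x \<in> A \<and> norm x < a}"
  let ?E = "range (\<lambda>a::real. {..<a})"
  let ?c = "emeasure lborel (?S 1)"
  have L: "emeasure ?L {..<a} = emeasure lborel (?S a)" for a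
  proof -
    have "emeasure ?L {..<a} = (\<integral>\<^sup>+x. indicator A (x /\<^sub>R norm x) * indicator (norm -` {..<a}) x \<partial>lborel)"
      by (subst emeasure_distr, simp, simp, subst emeasure_density)
         (auto intro!: measurable_sets_borel[of _ borel])
    also have "\<dots> = (\<integral>\<^sup>+x. indicator (?S a) x \<partial>lborel)"
      by (intro nn_integral_cong) (auto split: split_indicator)
    finally show ?thesis
      by (simp add: nn_integral_indicator)
  qed
  show "emeasure ?L X = emeasure ?R X" if X: "X \<in> ?E" for X
  proof -
    obtain a where a: "X = {..<a}" using X by auto
    have R: "emeasure ?R {..<a} =
        (\<integral>\<^sup>+r. emeasure sphere_surface A * (ennreal (r ^ (DIM('a) - 1)) * indicator {0<..<a} r) \<partial>lborel)"
      by (subst emeasure_density) (auto intro!: nn_integral_cong split: split_indicator)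
    show ?thesis
    proof (cases "0 < a")
      case False
      then have empty: "?S a = {}"
        by (auto simp: not_less intro: order_trans[OF _ norm_ge_zero])
      show ?thesis
        unfolding a L R empty using False by simp
    next
      case True
      \<comment> \<open>The endpoints are null, so the fundamental theorem on a closed interval
        applies.\<close>
      have "(\<integral>\<^sup>+r. ennreal (r ^ (DIM('a) - 1)) * indicator {0<..<a} r \<partial>lborel) =
        (\<integral>\<^sup>+r. ennreal (r ^ (DIM('a) - 1)) * indicator {0..a} r \<partial>lborel)"
        using AE_lborel_singleton[of "0::real"] AE_lborel_singleton[of a]
        by (intro nn_integral_cong_AE) (auto split: split_indicator elim!: eventually_elim2)
      also have "\<dots> = ennreal (a ^ DIM('a) / DIM('a) - 0 ^ DIM('a) / DIM('a))"
        using True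
        by (intro nn_integral_FTC_Icc) (auto intro!: derivative_eq_intros)
      finally have "emeasure ?R {..<a} = emeasure sphere_surface A * ennreal (a ^ DIM('a) / DIM('a))"
        unfolding R by (subst nn_integral_cmult) (auto simp: zero_power)
      also have "\<dots> = ennreal (real DIM('a)) * ennreal (a ^ DIM('a) / DIM('a)) * ?c"
        by (subst emeasure_sphere_surface_vimage) (auto simp: mult_ac)
      also have "\<dots> = ennreal (a ^ DIM('a)) * ?c"
        using True by (simp flip: ennreal_mult)
      also have "\<dots> = emeasure ?L {..<a}"
        unfolding L by (rule emeasure_lborel_cone_scale[OF assms True, symmetric])
      finally show ?thesis unfolding a by (rule sym)
    qed
  qed
  \<comment> \<open>Finiteness on an exhausting sequence of generators: a truncated cone lies in a
    ball.\<close>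
  show "emeasure ?L {..<real i} \<noteq> \<infinity>" for i :: nat
  proof -
    have "emeasure lborel (?S (real i)) \<le> emeasure lborel (ball (0::'a) i)"
      by (intro emeasure_mono) auto
    then show ?thesis
      unfolding L using emeasure_lborel_ball_finite[of "0::'a" "real i"] by (auto simp: top_unique)
  qed
  have "sets borel = sigma_sets UNIV ?E"
    by (subst borel_eq_lessThan) (simp add: eucl_lessThan)
  then show "sets ?L = sigma_sets UNIV ?E" "sets ?R = sigma_sets UNIV ?E"
    by auto
  show "Int_stable ?E"
  proof (rule Int_stableI)
    fix X Y assume "X \<in> ?E" "Y \<in> ?E"
    then obtain a b where "X = {..<a}" "Y = {..<b}" by blast
    then have "X \<inter> Y = {..<min a b}" by auto
    then show "X \<inter> Y \<in> ?E" by (rule range_eqI)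
  qed
  show "(\<Union>i. {..<real i}) = UNIV"
    using reals_Archimedean2 by auto
qed auto

text \<open>For a fixed radial weight \<open>h\<close>, push the measure with density
  \<open>h (norm x)\<close> forward under normalization. Integrating out the radius over each cone
  shows that the image is a multiple of the surface measure; this equality of measures then yields
  the formula for every \<open>g\<close>.\<close>

lemma nn_integral_polar:
  fixes g :: "'a::euclidean_space \<Rightarrow> ennreal" and h :: "real \<Rightarrow> ennreal"
  assumes g [measurable]: "g \<in> borel_measurable borel" and h [measurable]: "h \<in> borel_measurable borel"
  shows "(\<integral>\<^sup>+x. g (x /\<^sub>R norm x) * h (norm x) \<partial>lborel) =
    (\<integral>\<^sup>+u. g u \<partial>sphere_surface) *
    (\<integral>\<^sup>+r. ennreal (indicator {0<..} r * r ^ (DIM('a) - 1)) * h r \<partial>lborel)"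
proof -
  define c where "c = (\<integral>\<^sup>+r. ennreal (indicator {0<..} r * r ^ (DIM('a) - 1)) * h r \<partial>lborel)"
  have "distr (density lborel (\<lambda>x::'a. h (norm x))) borel (\<lambda>x. x /\<^sub>R norm x) =
      scale_measure c sphere_surface" (is "?L = ?R")
  proof (rule measure_eqI)
    fix A assume "A \<in> sets ?L"
    then have [measurable]: "A \<in> sets borel" by simp
    have "emeasure ?L A = (\<integral>\<^sup>+x. h (norm x) * indicator ((\<lambda>x::'a. x /\<^sub>R norm x) -` A) x \<partial>lborel)"
      by (subst emeasure_distr, simp, simp, subst emeasure_density)
         (auto intro!: measurable_sets_borel[of _ borel])
    also have "\<dots> = (\<integral>\<^sup>+x. indicator A (x /\<^sub>R norm x) * h (norm x) \<partial>lborel)"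
      by (intro nn_integral_cong) (auto split: split_indicator)
    also have "\<dots> = (\<integral>\<^sup>+r. h r \<partial>distr (density lborel (\<lambda>x. indicator A (x /\<^sub>R norm x))) borel norm)"
      by (subst nn_integral_distr, simp, simp, subst nn_integral_density) auto
    also have "\<dots> = emeasure sphere_surface A * c"
      unfolding distr_norm_cone[OF \<open>A \<in> sets borel\<close>] c_def
      by (subst nn_integral_density) (auto simp: nn_integral_cmult mult.assoc)
    finally show "emeasure ?L A = emeasure ?R A"
      by (simp add: mult.commute)
  qed simp
  then have "(\<integral>\<^sup>+x. g x \<partial>?L) = (\<integral>\<^sup>+x. g x \<partial>?R)" by simp
  then show ?thesis
    by (simp add: nn_integral_distr nn_integral_density nn_integral_scale_measure mult.commute c_def)
qed

section \<open>Gaussian moments on the half-line\<close>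

text \<open>Iterating the functional equation from \<open>Gamma (1 / 2) = sqrt pi\<close> gives the
  factorial form in which even Gaussian moments are known.\<close>

lemma Gamma_nat_plus_half:
  "Gamma (real k + 1 / 2) = sqrt pi * fact (2 * k) / (2 ^ (2 * k) * fact k)"
proof (induction k)
  case 0
  then show ?case by (simp add: Gamma_one_half_real)
next
  case (Suc k)
  have "Gamma (real (Suc k) + 1 / 2) = (real k + 1 / 2) * Gamma (real k + 1 / 2)"
    using Gamma_plus1[of "real k + 1 / 2"] nonpos_Ints_nonpos[of "real k + 1 / 2"]
    by (auto simp: add_ac)
  also have "\<dots> = sqrt pi * fact (2 * Suc k) / (2 ^ (2 * Suc k) * fact (Suc k))"
    unfolding Suc.IH by (simp add: divide_simps) (simp add: algebra_simps)
  finally show ?case .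
qed

text \<open>The value of the integral of \<open>x ^ k * exp (- x\<^sup>2)\<close> over the positive half-line.\<close>

definition gauss_moment :: "nat \<Rightarrow> real" where
  "gauss_moment k = Gamma ((real k + 1) / 2) / 2"

lemma gauss_moment_pos: "0 < gauss_moment k"
  by (simp add: gauss_moment_def)

lemma gauss_moment_add2: "gauss_moment (k + 2) = (real k + 1) / 2 * gauss_moment k"
proof -
  have "Gamma ((real k + 1) / 2 + 1) = (real k + 1) / 2 * Gamma ((real k + 1) / 2)"
    using nonpos_Ints_nonpos[of "(real k + 1) / 2"] by (intro Gamma_plus1) auto
  then show ?thesis
    by (simp add: gauss_moment_def add_divide_distrib add_ac)
qed

text \<open>Two steps of the recursion at once, since all exponents will change by multiples of
  4.\<close>

lemma gauss_moment_add4: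
  "gauss_moment (k + 4) = (real k + 3) / 2 * ((real k + 1) / 2) * gauss_moment k"
proof -
  have "gauss_moment (k + 4) = (real k + 3) / 2 * gauss_moment (k + 2)"
    using gauss_moment_add2[of "k + 2"] by (simp add: add.assoc del: add_2_eq_Suc add_2_eq_Suc')
  then show ?thesis
    unfolding gauss_moment_add2 by (simp only: mult.assoc)
qed

text \<open>Even and odd moments have different closed forms, one with \<open>sqrt pi\<close> and
  one without; the Gamma value unites them.\<close>

lemma nn_integral_gauss_moment:
  "(\<integral>\<^sup>+x. ennreal (indicator {0<..} x * x ^ k * exp (- x\<^sup>2)) \<partial>lborel) = ennreal (gauss_moment k)"
proof -
  have hb: "has_bochner_integral lborel (\<lambda>x::real. indicator {0..} x *\<^sub>R (exp (- x\<^sup>2) * x ^ k)) (gauss_moment k)"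
  proof (cases "even k")
    case True
    then obtain j where j: "k = 2 * j" by blast
    have "gauss_moment k = (sqrt pi / 2) * (fact (2 * j) / (2 ^ (2 * j) * fact j))"
      using Gamma_nat_plus_half[of j] by (simp add: gauss_moment_def j add_divide_distrib)
    then show ?thesis using gaussian_moment_even_pos[of j] j by simp
  next
    case False
    then obtain j where j: "k = 2 * j + 1" using oddE by blast
    have g: "gauss_moment k = fact j / 2"
      using Gamma_fact[of j, where 'a = real] by (simp add: gauss_moment_def j add_divide_distrib add_ac)
    show ?thesis unfolding g using gaussian_moment_odd_pos[of j] by (simp only: j)
  qed
  \<comment> \<open>The open and the closed half-line differ only by the null set
    \<open>{0}\<close>.\<close>
  have "(\<integral>\<^sup>+x. ennreal (indicator {0<..} x * x ^ k * exp (- x\<^sup>2)) \<partial>lborel) =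
      (\<integral>\<^sup>+x. ennreal (indicator {0..} x *\<^sub>R (exp (- x\<^sup>2) * x ^ k)) \<partial>lborel)"
    using AE_lborel_singleton[of "0::real"]
    by (intro nn_integral_cong_AE) (auto split: split_indicator simp: mult_ac elim!: eventually_mono)
  also have "\<dots> = ennreal (gauss_moment k)"
    using hb by (intro nn_integral_eq_integral[THEN trans])
      (auto simp: has_bochner_integral_iff split: split_indicator)
  finally show ?thesis .
qed

section \<open>Monomials on the positive part of the sphere\<close>

lemma nn_integral_lborel_prod_vec:
  fixes f :: "'m::finite \<Rightarrow> real \<Rightarrow> ennreal"
  assumes [measurable]: "\<And>i. f i \<in> borel_measurable borel"
  shows "(\<integral>\<^sup>+x. (\<Prod>i\<in>UNIV. f i (x $ i)) \<partial>lborel) = (\<Prod>i\<in>UNIV. \<integral>\<^sup>+t. f i t \<partial>lborel)"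
proof -
  \<comment> \<open>The product formula for \<open>lborel\<close> is indexed by basis vectors;
    \<open>ix\<close> recovers the coordinate index from a basis vector.\<close>
  define ix :: "real ^ 'm \<Rightarrow> 'm" where "ix = inv (\<lambda>i. axis i 1)"
  have inj: "inj (\<lambda>i::'m. axis i (1::real))" by (simp add: inj_def axis_eq_axis)
  have B: "(Basis :: (real ^ 'm) set) = range (\<lambda>i. axis i 1)" by (auto simp: Basis_vec_def)
  have ix: "ix (axis i 1) = i" for i unfolding ix_def by (rule inv_f_f[OF inj])
  have "(\<integral>\<^sup>+x. (\<Prod>b\<in>Basis. f (ix b) (x \<bullet> b)) \<partial>lborel) = (\<Prod>b\<in>Basis. \<integral>\<^sup>+t. f (ix b) t \<partial>lborel)"
    by (intro nn_integral_lborel_prod) auto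
  then show ?thesis
    unfolding B by (simp add: prod.reindex[OF inj] ix inner_axis)
qed

lemma pos_sphere_measurable [measurable]: "(pos_sphere :: (real ^ 'm) set) \<in> sets borel"
  unfolding pos_sphere_def sphere_def by measurable

text \<open>One integral over the positive orthant is evaluated twice. In polar coordinates it is
  the wanted integral times a radial Gaussian moment, whose exponent adds the Jacobian's
  \<open>CARD('m) - 1\<close> to the degree of the monomial; in Cartesian coordinates it
  factors.\<close>

lemma nn_integral_pos_sphere_monomial:
  fixes p :: "'m::finite \<Rightarrow> nat"
  shows "(\<integral>\<^sup>+u. ennreal (indicator pos_sphere u * (\<Prod>i\<in>UNIV. (u $ i) ^ p i)) \<partial>sphere_surface) =
    ennreal ((\<Prod>i\<in>UNIV. gauss_moment (p i)) / gauss_moment (CARD('m) - 1 + (\<Sum>i\<in>UNIV. p i)))"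
    (is "?I = _")
proof -
  define d where "d = (\<Sum>i\<in>UNIV. p i)"
  let ?K = "gauss_moment (CARD('m) - 1 + d)"
  let ?g = "\<lambda>u::real^'m. ennreal (indicator pos_sphere u * (\<Prod>i\<in>UNIV. (u $ i) ^ p i))"
  let ?h = "\<lambda>r::real. ennreal (r ^ d * exp (- r\<^sup>2))"
  \<comment> \<open>The factor \<open>r ^ d\<close> in \<open>?h\<close> undoes the normalization,
    because the monomial is homogeneous of degree \<open>d\<close>.\<close>
  have eq: "?g (x /\<^sub>R norm x) * ?h (norm x) =
      (\<Prod>i\<in>UNIV. ennreal (indicator {0<..} (x $ i) * (x $ i) ^ p i * exp (- (x $ i)\<^sup>2)))" for x
  proof (cases "\<forall>i. 0 < x $ i")
    case True
    then have x: "x \<noteq> 0" by (metis less_irrefl zero_index)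
    with True have "x /\<^sub>R norm x \<in> pos_sphere" by (auto simp: pos_sphere_def)
    then have "?g (x /\<^sub>R norm x) * ?h (norm x) =
        ennreal ((\<Prod>i\<in>UNIV. ((x /\<^sub>R norm x) $ i) ^ p i) * (norm x ^ d * exp (- (norm x)\<^sup>2)))"
      using True by (simp add: ennreal_mult prod_nonneg less_imp_le)
    \<comment> \<open>Both radial factors split over coordinates: \<open>d\<close> is the sum of the
      \<open>p i\<close>, and the squared norm is the sum of the squared coordinates.\<close>
    also have "(\<Prod>i\<in>UNIV. ((x /\<^sub>R norm x) $ i) ^ p i) * (norm x ^ d * exp (- (norm x)\<^sup>2)) =
        (\<Prod>i\<in>UNIV. ((x /\<^sub>R norm x) $ i) ^ p i) * (\<Prod>i\<in>UNIV. norm x ^ p i * exp (- (x $ i)\<^sup>2))"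
      by (simp add: d_def power_sum norm_vec_def L2_set_def sum_nonneg prod.distrib exp_sum flip: sum_negf)
    also have "\<dots> = (\<Prod>i\<in>UNIV. (x $ i) ^ p i * exp (- (x $ i)\<^sup>2))"
      unfolding prod.distrib[symmetric] using x
      by (intro prod.cong refl) (simp add: power_mult_distrib power_inverse)
    finally show ?thesis
      using True by (simp add: prod_ennreal less_imp_le)
  next
    \<comment> \<open>Normalization creates no positive coordinate, so both sides vanish; this
      covers \<open>x = 0\<close>.\<close>
    case False
    then obtain i where i: "\<not> 0 < x $ i" by auto
    then have "x /\<^sub>R norm x \<notin> pos_sphere"
      by (auto simp: pos_sphere_def zero_less_mult_iff intro!: exI[of _ i])
    with i show ?thesis
      by (auto simp: prod_zero_iff intro!: exI[of _ i])
  qed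
  have "?I * ennreal ?K = ?I * (\<integral>\<^sup>+r. ennreal (indicator {0<..} r * r ^ (CARD('m) - 1)) * ?h r \<partial>lborel)"
    unfolding nn_integral_gauss_moment[symmetric] power_add
    by (intro arg_cong2[of _ _ _ _ "(*)"] nn_integral_cong refl)
       (auto split: split_indicator simp: mult_ac simp flip: ennreal_mult)
  also have "\<dots> = (\<integral>\<^sup>+x. ?g (x /\<^sub>R norm x) * ?h (norm x) \<partial>lborel)"
    by (subst nn_integral_polar) auto
  also have "\<dots> = (\<Prod>i\<in>UNIV. \<integral>\<^sup>+t. ennreal (indicator {0<..} t * t ^ p i * exp (- t\<^sup>2)) \<partial>lborel)"
    unfolding eq by (subst nn_integral_lborel_prod_vec) auto
  also have "\<dots> = ennreal (\<Prod>i\<in>UNIV. gauss_moment (p i))"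
    unfolding nn_integral_gauss_moment by (simp add: prod_ennreal gauss_moment_pos less_imp_le)
  \<comment> \<open>Cancelling is legitimate in \<open>ennreal\<close> because \<open>?K\<close> is
    real and positive.\<close>
  finally have "?I * ennreal ?K / ennreal ?K = ennreal (\<Prod>i\<in>UNIV. gauss_moment (p i)) / ennreal ?K"
    by (simp only:)
  also have "\<dots> = ennreal ((\<Prod>i\<in>UNIV. gauss_moment (p i)) / ?K)"
    by (intro divide_ennreal prod_nonneg) (auto simp: gauss_moment_pos less_imp_le)
  finally show ?thesis
    unfolding d_def[symmetric] using gauss_moment_pos[of "CARD('m) - 1 + d"]
    by (subst (asm) mult_divide_eq_ennreal) auto
qed

text \<open>Normalizing divides by the integral of the constant monomial. The value is grouped into
  ratios so that coordinates with exponent 0 contribute a factor 1.\<close>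

lemma monomial_moment:
  fixes p :: "'m::finite \<Rightarrow> nat"
  shows "has_bochner_integral (uniform_measure sphere_surface pos_sphere)
    (\<lambda>u::real^'m. \<Prod>i\<in>UNIV. (u $ i) ^ p i)
    ((\<Prod>i\<in>UNIV. gauss_moment (p i) / gauss_moment 0) *
     (gauss_moment (CARD('m) - 1) / gauss_moment (CARD('m) - 1 + (\<Sum>i\<in>UNIV. p i))))"
    (is "has_bochner_integral ?U ?f ?v")
proof (rule has_bochner_integral_nn_integral)
  let ?G = gauss_moment and ?d = "\<Sum>i\<in>UNIV. p i"
  note pos = gauss_moment_pos
  \<comment> \<open>All exponents zero: the monomial is 1 and its integral is the surface
    measure.\<close>
  have E: "emeasure sphere_surface (pos_sphere :: (real^'m) set) =
      ennreal (?G 0 ^ CARD('m) / ?G (CARD('m) - 1))"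
    using nn_integral_pos_sphere_monomial[of "\<lambda>_::'m. 0"]
    by (simp add: nn_integral_indicator ennreal_indicator)
  show "?f \<in> borel_measurable ?U" by simp
  show "AE x in ?U. 0 \<le> ?f x"
    by (rule AE_uniform_measureI) (auto simp: pos_sphere_def intro!: AE_I2 prod_nonneg zero_le_power simp: less_imp_le)
  show "0 \<le> ?v"
    by (intro mult_nonneg_nonneg prod_nonneg divide_nonneg_nonneg ballI less_imp_le[OF pos])
  have "(\<integral>\<^sup>+u. ennreal (?f u) \<partial>?U) = (\<integral>\<^sup>+u. ennreal (?f u) * indicator pos_sphere u \<partial>sphere_surface) /
      emeasure sphere_surface (pos_sphere :: (real^'m) set)"
    by (rule nn_integral_uniform_measure) auto
  also have "(\<integral>\<^sup>+u. ennreal (?f u) * indicator pos_sphere u \<partial>sphere_surface) =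
      (\<integral>\<^sup>+u. ennreal (indicator pos_sphere u * ?f u) \<partial>sphere_surface)"
    by (intro nn_integral_cong) (auto split: split_indicator)
  also have "\<dots> / emeasure sphere_surface (pos_sphere :: (real^'m) set) =
      ennreal ((\<Prod>i\<in>UNIV. ?G (p i)) / ?G (CARD('m) - 1 + ?d) / (?G 0 ^ CARD('m) / ?G (CARD('m) - 1)))"
    unfolding E nn_integral_pos_sphere_monomial
    by (intro divide_ennreal divide_nonneg_pos divide_pos_pos prod_nonneg ballI zero_less_power
        pos less_imp_le[OF pos])
  also have "(\<Prod>i\<in>UNIV. ?G (p i)) / ?G (CARD('m) - 1 + ?d) / (?G 0 ^ CARD('m) / ?G (CARD('m) - 1)) = ?v"
    by (simp only: prod_dividef prod_constant divide_divide_eq_left divide_divide_eq_right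
        times_divide_eq_left times_divide_eq_right mult.commute)
  finally show "(\<integral>\<^sup>+u. ennreal (?f u) \<partial>?U) = ennreal ?v" .
qed

section \<open>Moments of degree four and eight\<close>

text \<open>The recursion yields \<open>1 * 3 / 2 ^ 2\<close> and
  \<open>1 * 3 * 5 * 7 / 2 ^ 4\<close>.\<close>

lemma gauss_moment_ratio:
  "gauss_moment 4 / gauss_moment 0 = 3 / 4" "gauss_moment 8 / gauss_moment 0 = 105 / 16"
proof -
  have 4: "gauss_moment 4 = 3 / 4 * gauss_moment 0"
    using gauss_moment_add4[of 0] by simp
  have 8: "gauss_moment 8 = 35 / 4 * gauss_moment 4"
    using gauss_moment_add4[of 4] by simp
  show "gauss_moment 4 / gauss_moment 0 = 3 / 4" "gauss_moment 8 / gauss_moment 0 = 105 / 16"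
    unfolding 8 unfolding 4 using gauss_moment_pos[of 0] by simp_all
qed

text \<open>These are the radial factors in \<open>monomial_moment\<close> for total degree 4 and
  8.\<close>

lemma gauss_moment_shift:
  assumes "0 < n"
  shows "gauss_moment (n - 1) / gauss_moment (n - 1 + 4) = 4 / (real n * (real n + 2))"
    and "gauss_moment (n - 1) / gauss_moment (n - 1 + 8) =
      16 / (real n * (real n + 2) * (real n + 4) * (real n + 6))"
proof -
  define k where "k = n - 1"
  have n: "real n = real k + 1" using assms by (simp add: k_def of_nat_diff)
  have 8: "gauss_moment (k + 8) = (real k + 7) / 2 * ((real k + 5) / 2) * gauss_moment (k + 4)"
    using gauss_moment_add4[of "k + 4"] by (simp add: add.assoc)
  have pos: "gauss_moment k \<noteq> 0"
    using gauss_moment_pos[of k] by simp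
  show "gauss_moment (n - 1) / gauss_moment (n - 1 + 4) = 4 / (real n * (real n + 2))"
    using pos unfolding n gauss_moment_add4 k_def[symmetric] by (simp add: add.assoc)
  show "gauss_moment (n - 1) / gauss_moment (n - 1 + 8) =
      16 / (real n * (real n + 2) * (real n + 4) * (real n + 6))"
    using pos unfolding n 8 gauss_moment_add4 k_def[symmetric] by (simp add: add.assoc)
qed

lemma fourth_moment:
  fixes i :: "'m::finite"
  shows "has_bochner_integral (uniform_measure sphere_surface pos_sphere) (\<lambda>u::real^'m. (u $ i) ^ 4)
    (3 / (real CARD('m) * (real CARD('m) + 2)))"
proof -
  define p where "p j = (if j = i then 4 else 0 :: nat)" for j
  have "(\<Prod>j\<in>UNIV. (u $ j) ^ p j) = (u $ i) ^ 4" for u :: "real^'m"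
    by (simp add: p_def if_distrib[of "\<lambda>k. _ ^ k"] prod.delta cong: if_cong)
  moreover have "(\<Prod>j\<in>UNIV. gauss_moment (p j) / gauss_moment 0) = 3 / 4"
    using gauss_moment_pos[of 0]
    by (simp add: p_def if_distrib[of "\<lambda>k. gauss_moment k / _"] prod.delta gauss_moment_ratio cong: if_cong)
  moreover have "(\<Sum>j\<in>UNIV. p j) = 4"
    by (simp add: p_def)
  ultimately show ?thesis
    using monomial_moment[of p] by (simp only: gauss_moment_shift zero_less_card_finite) simp
qed

lemma mixed_moment:
  fixes i j :: "'m::finite"
  shows "has_bochner_integral (uniform_measure sphere_surface pos_sphere)
    (\<lambda>u::real^'m. (u $ i) ^ 4 * (u $ j) ^ 4)
    ((if i = j then 105 else 9) /
      (real CARD('m) * (real CARD('m) + 2) * (real CARD('m) + 4) * (real CARD('m) + 6)))"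
proof -
  \<comment> \<open>The sum makes the exponent 8 when \<open>i = j\<close>, giving
    \<open>105 / 16\<close>; otherwise two exponents are 4, giving
    \<open>(3 / 4)\<^sup>2 = 9 / 16\<close>. The 16 cancels against the radial factor.\<close>
  define p where "p l = (if l = i then 4 else 0) + (if l = j then 4 else 0 :: nat)" for l
  have "(\<Prod>l\<in>UNIV. (u $ l) ^ p l) = (u $ i) ^ 4 * (u $ j) ^ 4" for u :: "real^'m"
    by (simp add: p_def power_add prod.distrib if_distrib[of "\<lambda>k. _ ^ k"] prod.delta cong: if_cong)
  moreover have "(\<Prod>l\<in>UNIV. gauss_moment (p l) / gauss_moment 0) = (if i = j then 105 else 9) / 16"
  proof (cases "i = j")
    case True
    then have "p l = (if l = i then 8 else 0)" for l by (simp add: p_def)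
    with True show ?thesis
      using gauss_moment_pos[of 0]
      by (simp add: if_distrib[of "\<lambda>k. gauss_moment k / _"] prod.delta gauss_moment_ratio cong: if_cong)
  next
    case False
    then have "gauss_moment (p l) / gauss_moment 0 = (if l = i then 3 / 4 else 1) * (if l = j then 3 / 4 else 1)" for l
      using gauss_moment_pos[of 0] by (auto simp: p_def gauss_moment_ratio)
    with False show ?thesis
      by (simp add: prod.distrib prod.delta)
  qed
  moreover have "(\<Sum>l\<in>UNIV. p l) = 8"
    by (simp add: p_def sum.distrib)
  ultimately show ?thesis
    using monomial_moment[of p] by (simp only: gauss_moment_shift zero_less_card_finite) simp
qed

section \<open>Expectation and variance\<close>

theorem lemma3p3:
  fixes M :: "'a measure" and \<eta> :: "'a \<Rightarrow> real ^ 'm"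
  assumes "prob_space M"
    and "\<eta> \<in> borel_measurable M"
    and "distr M borel \<eta> = uniform_measure sphere_surface pos_sphere"
  shows "prob_space.expectation M (\<lambda>\<omega>. \<Sum>i\<in>UNIV. (\<eta> \<omega> $ i) ^ 4)
           = 3 / (real CARD('m) + 2) \<and>
         prob_space.variance M (\<lambda>\<omega>. \<Sum>i\<in>UNIV. (\<eta> \<omega> $ i) ^ 4)
           = (24 * real CARD('m) - 24) /
             ((real CARD('m) + 2)\<^sup>2 * (real CARD('m) + 4) * (real CARD('m) + 6))"
proof -
  interpret prob_space M by fact
  note [measurable] = assms(2)
  define n where "n = real CARD('m)"
  have n: "0 < n" by (simp add: n_def)
  define X where "X = (\<lambda>\<omega>. \<Sum>i\<in>UNIV. (\<eta> \<omega> $ i) ^ 4)"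
  \<comment> \<open>Change of variables along \<eta>, whose distribution is the uniform one.\<close>
  have transfer: "has_bochner_integral M (\<lambda>\<omega>. f (\<eta> \<omega>)) c"
    if "has_bochner_integral (uniform_measure sphere_surface pos_sphere) f c"
      "f \<in> borel_measurable borel" for f :: "real^'m \<Rightarrow> real" and c
    using that unfolding assms(3)[symmetric]
    by (simp add: has_bochner_integral_iff integrable_distr_eq integral_distr)
  have "has_bochner_integral M X (\<Sum>i\<in>(UNIV::'m set). 3 / (n * (n + 2)))"
    unfolding X_def n_def by (intro has_bochner_integral_sum transfer fourth_moment) auto
  also have "(\<Sum>i\<in>(UNIV::'m set). 3 / (n * (n + 2))) = 3 / (n + 2)"
    using n by (simp flip: n_def)
  finally have 1: "has_bochner_integral M X (3 / (n + 2))" .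
  let ?D = "n * (n + 2) * (n + 4) * (n + 6)"
  have sq: "(X \<omega>)\<^sup>2 = (\<Sum>i\<in>UNIV. \<Sum>j\<in>UNIV. (\<eta> \<omega> $ i) ^ 4 * (\<eta> \<omega> $ j) ^ 4)" for \<omega>
    by (simp add: X_def power2_eq_square sum_product)
  have "has_bochner_integral M (\<lambda>\<omega>. (X \<omega>)\<^sup>2)
      (\<Sum>i\<in>(UNIV::'m set). \<Sum>j\<in>(UNIV::'m set). (if i = j then 105 else 9) / ?D)"
    unfolding sq n_def by (intro has_bochner_integral_sum transfer mixed_moment) auto
  \<comment> \<open>Give every pair the off-diagonal value 9 and add the excess
    \<open>96 = 105 - 9\<close> on the \<open>n\<close> diagonal pairs.\<close>
  also have "(\<Sum>i\<in>(UNIV::'m set). \<Sum>j\<in>(UNIV::'m set). (if i = j then 105 else 9) / ?D) =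
      (\<Sum>i\<in>(UNIV::'m set). \<Sum>j\<in>(UNIV::'m set). 9 / ?D + (if i = j then 96 / ?D else 0))"
    by (intro sum.cong refl) (simp add: add_divide_distrib[symmetric])
  also have "\<dots> = n * (9 * n + 96) / ?D"
    by (simp add: sum.distrib n_def[symmetric] add_divide_distrib distrib_left)
  also have "\<dots> = (9 * n + 96) / ((n + 2) * (n + 4) * (n + 6))"
    using n by simp
  finally have 2: "has_bochner_integral M (\<lambda>\<omega>. (X \<omega>)\<^sup>2) ((9 * n + 96) / ((n + 2) * (n + 4) * (n + 6)))" .
  have "variance X = (9 * n + 96) / ((n + 2) * (n + 4) * (n + 6)) - (3 / (n + 2))\<^sup>2"
    using 1 2 variance_eq[of X] by (simp add: has_bochner_integral_iff)
  \<comment> \<open>Over the common denominator the quadratic terms cancel: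
    \<open>(9 * n + 96) * (n + 2) - 9 * (n + 4) * (n + 6) = 24 * n - 24\<close>.\<close>
  also have "\<dots> = (24 * n - 24) / ((n + 2)\<^sup>2 * (n + 4) * (n + 6))"
    using n by (simp add: divide_simps) (simp add: algebra_simps power2_eq_square)
  finally have "variance X = (24 * n - 24) / ((n + 2)\<^sup>2 * (n + 4) * (n + 6))" .
  moreover have "expectation X = 3 / (n + 2)"
    using 1 by (simp add: has_bochner_integral_iff)
  ultimately show ?thesis
    unfolding X_def n_def by blast
qed

end
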